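(* Let $T$ and $\hat T$ be the exact and hybrid random-scan Gibbs kernels on $\mathsf X=\mathsf X_1\times\cdots\times\mathsf X_n$ targeting $\Pi$ (defined in the context). Suppose that there exist constants $c_1,c_2\in[0,2]$ such that $$c_1\le \frac{\mathcal E_{Q_{i,y}}(g)}{\|g\|_{\Pi_{i,y}}^2}\le c_2$$ for $i=1,\dots,n$, $M_{-i}$-a.e. $y\in\mathsf X_{-i}$, and every $g\in L_0^2(\Pi_{i,y})\setminus\{0\}$. Then, for every $f\in L_0^2(\Pi)$, $$c_1\,\mathcal E_T(f)\le \mathcal E_{\hat T}(f)\le c_2\,\mathcal E_T(f).$$
   Context: $L^2$ conventions. For a probability space $(\mathsf Y,\mathcal F,\omega)$, $L^2(\omega)$ is the real Hilbert space of square-integrable functions (modulo a.e. equality) with inner product $\langle f,g\rangle_\omega=\int fg\,d\omega$ and norm $\|\cdot\|_\omega$; $L_0^2(\omega)=\{f\in L^2(\omega):\int f\,d\omega=0\}$. A Markov transition kernel (Mtk) $K$ on $\mathsf Y$ reversible with respect to $\omega$ acts as a self-adjoint operator on $L_0^2(\omega)$ by $Kf(y)=\int K(y,dy')f(y')$. Its Dirichlet form is, for $f\in L^2(\omega)$, $\mathcal E_K(f)=\|f-\omega f\|_\omega^2-\langle f-\omega f,K(f-\omega f)\rangle_\omega=\tfrac12\int\int\omega(dy)K(y,dy')[f(y)-f(y')]^2$, where $\omega f=\int f\,d\omega$. Gibbs setting. $(\mathsf X,\mathcal B)$ is the product of Polish spaces $\mathsf X_1,\dots,\mathsf X_n$ with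 Borel $\sigma$-algebras $\mathcal B_1,\dots,\mathcal B_n$, and $\Pi$ is a probability measure on $(\mathsf X,\mathcal B)$. For $x\in\mathsf X$, $x_{-i}$ is $x$ with the $i$th component removed, $\mathsf X_{-i}=\{x_{-i}:x\in\mathsf X\}$. For $X\sim\Pi$, $M_{-i}$ is the distribution of $X_{-i}$ and $\Pi_{i,y}$ is the conditional distribution of $X_i$ given $X_{-i}=y$. For each $i$ and $y\in\mathsf X_{-i}$, $Q_{i,y}:\mathsf X_i\times\mathcal B_i\to[0,1]$ is an Mtk reversible with respect to $\Pi_{i,y}$, and for every $i$ and $A\in\mathcal B_i$ the map $x\mapsto Q_{i,x_{-i}}(x_i,A)$ is measurable. Let $p_1,\dots,p_n\ge0$ with $\sum_i p_i=1$, and let $\delta$ denote a point mass. Define $$T(x,dx')=\sum_{i=1}^n p_i\,\Pi_{i,x_{-i}}(dx_i')\,\delta_{x_{-i}}(dx_{-i}'),\qquad \hat T(x,dx')=\sum_{i=1}^n p_i\,Q_{i,x_{-i}}(x_i,dx_i')\,\delta_{x_{-i}}(dx_{-i}').$$ Both are reversible with respect to $\Pi$. *)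

theory Defs
  imports "HOL-Probability.Probability"
begin

text \<open>
  Elements of \<open>L\<^sup>2(\<omega>)\<close> are represented by square-integrable functions; two representatives of
  the same element agree \<open>\<omega>\<close>-almost everywhere, so being nonzero means
  \<open>\<not> (AE x in \<omega>. f x = 0)\<close>.
\<close>

definition L2 :: "'a measure \<Rightarrow> ('a \<Rightarrow> real) set" where
  "L2 \<omega> = {f \<in> borel_measurable \<omega>. integrable \<omega> (\<lambda>x. (f x)\<^sup>2)}"

definition L2_0 :: "'a measure \<Rightarrow> ('a \<Rightarrow> real) set" where
  "L2_0 \<omega> = {f \<in> L2 \<omega>. (\<integral>x. f x \<partial>\<omega>) = 0}"

definition L2_inner :: "'a measure \<Rightarrow> ('a \<Rightarrow> real) \<Rightarrow> ('a \<Rightarrow> real) \<Rightarrow> real" where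
  "L2_inner \<omega> f g = (\<integral>x. f x * g x \<partial>\<omega>)"

definition L2_norm :: "'a measure \<Rightarrow> ('a \<Rightarrow> real) \<Rightarrow> real" where
  "L2_norm \<omega> f = sqrt (L2_inner \<omega> f f)"

definition markov_kernel :: "'a measure \<Rightarrow> ('a \<Rightarrow> 'a measure) \<Rightarrow> bool" where
  "markov_kernel Y K \<longleftrightarrow> K \<in> Y \<rightarrow>\<^sub>M prob_algebra Y"

text \<open>Equality of the measures \<open>\<omega>(dy) K(y, dy')\<close> and \<open>\<omega>(dy') K(y', dy)\<close> on rectangles.\<close>

definition reversible_wrt :: "('a \<Rightarrow> 'a measure) \<Rightarrow> 'a measure \<Rightarrow> bool" where
  "reversible_wrt K \<omega> \<longleftrightarrow>
    (\<forall>A\<in>sets \<omega>. \<forall>B\<in>sets \<omega>.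
      (\<integral>\<^sup>+y\<in>A. emeasure (K y) B \<partial>\<omega>) = (\<integral>\<^sup>+y\<in>B. emeasure (K y) A \<partial>\<omega>))"

definition kernel_op :: "('a \<Rightarrow> 'a measure) \<Rightarrow> ('a \<Rightarrow> real) \<Rightarrow> 'a \<Rightarrow> real" where
  "kernel_op K f y = (\<integral>y'. f y' \<partial>K y)"

definition dirichlet_form ::
  "'a measure \<Rightarrow> ('a \<Rightarrow> 'a measure) \<Rightarrow> ('a \<Rightarrow> real) \<Rightarrow> real" where
  "dirichlet_form \<omega> K f =
    (let h = (\<lambda>y. f y - (\<integral>z. f z \<partial>\<omega>))
     in (L2_norm \<omega> h)\<^sup>2 - L2_inner \<omega> h (kernel_op K h))"

definition polish_space :: "'a topology \<Rightarrow> bool" where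
  "polish_space X \<longleftrightarrow> completely_metrizable_space X \<and> separable_space X"

definition borel_of :: "'a topology \<Rightarrow> 'a measure" where
  "borel_of X = sigma (topspace X) {U. openin X U}"

text \<open>
  The component spaces are topologies on subsets of one common type. This does not force them to
  be equal: any finite family of Polish spaces can be transported to a common type. A point of the
  product is a function on \<open>{1..n}\<close> that is \<open>undefined\<close> elsewhere, and removing the \<open>i\<close>-th
  component is restriction to \<open>{1..n} - {i}\<close>.
\<close>

definition prod_space :: "nat \<Rightarrow> (nat \<Rightarrow> 'a topology) \<Rightarrow> (nat \<Rightarrow> 'a) measure" where
  "prod_space n X = (\<Pi>\<^sub>M j\<in>{1..n}. borel_of (X j))"

definition prod_space_minus ::
  "nat \<Rightarrow> (nat \<Rightarrow> 'a topology) \<Rightarrow> nat \<Rightarrow> (nat \<Rightarrow> 'a) measure" where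
  "prod_space_minus n X i = (\<Pi>\<^sub>M j\<in>{1..n} - {i}. borel_of (X j))"

definition remove_comp :: "nat \<Rightarrow> nat \<Rightarrow> (nat \<Rightarrow> 'a) \<Rightarrow> nat \<Rightarrow> 'a" where
  "remove_comp n i x = restrict x ({1..n} - {i})"

definition marginal_minus ::
  "nat \<Rightarrow> (nat \<Rightarrow> 'a topology) \<Rightarrow> (nat \<Rightarrow> 'a) measure \<Rightarrow> nat \<Rightarrow> (nat \<Rightarrow> 'a) measure" where
  "marginal_minus n X \<mu> i = distr \<mu> (prod_space_minus n X i) (remove_comp n i)"

text \<open>
  \<open>\<kappa>\<close> is a (regular) conditional distribution under \<open>M\<close> of the \<open>S\<close>-valued variable \<open>V\<close> given the
  \<open>R\<close>-valued variable \<open>W\<close>. It is determined only up to null sets of the law of \<open>W\<close>.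
\<close>

definition conditional_distribution ::
  "'w measure \<Rightarrow> 'a measure \<Rightarrow> ('w \<Rightarrow> 'a) \<Rightarrow> 'b measure \<Rightarrow> ('w \<Rightarrow> 'b) \<Rightarrow> ('b \<Rightarrow> 'a measure) \<Rightarrow> bool"
  where
  "conditional_distribution M S V R W \<kappa> \<longleftrightarrow>
    \<kappa> \<in> R \<rightarrow>\<^sub>M prob_algebra S \<and>
    (\<forall>A\<in>sets S. \<forall>C\<in>sets R.
      emeasure M {x \<in> space M. V x \<in> A \<and> W x \<in> C} = (\<integral>\<^sup>+y\<in>C. emeasure (\<kappa> y) A \<partial>distr M R W))"

text \<open>
  The measure \<open>\<nu>(dx\<^sub>i') \<delta>\<^bsub>y\<^esub>(dx\<^bsub>-i\<^esub>')\<close> on the full product, where \<open>\<nu>\<close> lives on the \<open>i\<close>-th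
  component and \<open>y\<close> has the \<open>i\<close>-th component removed.
\<close>

definition insert_comp ::
  "nat \<Rightarrow> (nat \<Rightarrow> 'a topology) \<Rightarrow> nat \<Rightarrow> 'a measure \<Rightarrow> (nat \<Rightarrow> 'a) \<Rightarrow> (nat \<Rightarrow> 'a) measure" where
  "insert_comp n X i \<nu> y =
    distr (\<nu> \<Otimes>\<^sub>M return (prod_space_minus n X i) y) (prod_space n X) (\<lambda>(a, z). z(i := a))"

definition exact_gibbs ::
  "nat \<Rightarrow> (nat \<Rightarrow> 'a topology) \<Rightarrow> (nat \<Rightarrow> real) \<Rightarrow> (nat \<Rightarrow> (nat \<Rightarrow> 'a) \<Rightarrow> 'a measure)
    \<Rightarrow> (nat \<Rightarrow> 'a) \<Rightarrow> (nat \<Rightarrow> 'a) measure" where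
  "exact_gibbs n X p P x =
    measure_of (space (prod_space n X)) (sets (prod_space n X))
      (\<lambda>B. \<Sum>i=1..n. ennreal (p i) *
        emeasure (insert_comp n X i (P i (remove_comp n i x)) (remove_comp n i x)) B)"

definition hybrid_gibbs ::
  "nat \<Rightarrow> (nat \<Rightarrow> 'a topology) \<Rightarrow> (nat \<Rightarrow> real)
    \<Rightarrow> (nat \<Rightarrow> (nat \<Rightarrow> 'a) \<Rightarrow> 'a \<Rightarrow> 'a measure)
    \<Rightarrow> (nat \<Rightarrow> 'a) \<Rightarrow> (nat \<Rightarrow> 'a) measure" where
  "hybrid_gibbs n X p Q x =
    measure_of (space (prod_space n X)) (sets (prod_space n X))
      (\<lambda>B. \<Sum>i=1..n. ennreal (p i) *
        emeasure (insert_comp n X i (Q i (remove_comp n i x) (x i)) (remove_comp n i x)) B)"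

end

theory Submission
  imports Defs
begin

text \<open>
  Disintegrating \<open>\<mu>\<close> over \<open>x\<^bsub>-i\<^esub>\<close> turns the Dirichlet form of the \<open>i\<close>-th
  component of the hybrid sampler into the integral over \<open>y\<close> of the Dirichlet forms of \<open>Q i y\<close>
  at the sections of \<open>f\<close>. The exact sampler is the hybrid one with \<open>Q i y a = P i y\<close>, whose
  fibrewise Dirichlet form is the variance of the section. The hypothesis compares the two integrands
  almost everywhere, and both Dirichlet forms of the random scans are the \<open>p\<close>-averages of
  those of their components.
\<close>

text \<open>The obstacle is integrability. \<open>dirichlet_form\<close> and
  \<open>kernel_op\<close> are built from Bochner integrals, which take the value 0 on
  non-integrable functions, so linearity under \<open>K x\<close> or \<open>P y\<close> can be used
  only where \<open>f\<close> is integrable for that particular measure. Invariance supplies this: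
  since \<open>\<omega> \<bind> K = \<omega>\<close>, square integrability under \<omega> passes to
  \<open>K x\<close> for almost every \<open>x\<close>. The same argument, applied to the
  disintegration of \<mu> as a mixture of its conditional laws, passes it to almost every fibre.
  Reversibility of the fibre kernels enters through this invariance.

  A second mismatch is centring. The mean of \<open>f\<close> is zero, but the means of its sections
  vary with the fibre, while the gap is assumed for centred functions only. The centred sections
  inherit the bound because \<open>dirichlet_form\<close> centres its argument anyway.\<close>

section \<open>Integration against a mixture of kernels\<close>

text \<open>Fubini for \<open>M \<bind> N\<close> under mere integrability of \<open>f\<close>.
  Tonelli settles nonnegative functions; the general case is the difference of positive and negative
  parts.\<close>

lemma
  fixes f :: "'b \<Rightarrow> real"
  assumes M: "prob_space M" and N: "N \<in> M \<rightarrow>\<^sub>M subprob_algebra B"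
    and f: "integrable (M \<bind> N) f"
  shows AE_integrable_bind: "AE x in M. integrable (N x) f"
    and integrable_integral_bind: "integrable M (\<lambda>x. \<integral>y. f y \<partial>N x)"
    and integral_bind_integrable: "(\<integral>y. f y \<partial>(M \<bind> N)) = (\<integral>x. \<integral>y. f y \<partial>N x \<partial>M)"
proof -
  interpret prob_space M by fact
  note N[measurable]
  have sB: "sets (M \<bind> N) = sets B"
    using sets_kernel[OF N] not_empty by (intro sets_bind) auto
  have sN: "x \<in> space M \<Longrightarrow> sets (N x) = sets B" for x
    using sets_kernel[OF N] by auto
  have *: "(AE x in M. integrable (N x) g) \<and>
      has_bochner_integral M (\<lambda>x. \<integral>y. g y \<partial>N x) (\<integral>y. g y \<partial>(M \<bind> N))"
    if g: "integrable (M \<bind> N) g" and nn: "\<And>y. 0 \<le> g y" for g :: "'b \<Rightarrow> real"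
  proof -
    have gB[measurable]: "g \<in> borel_measurable B"
      using borel_measurable_integrable[OF g] by (simp cong: measurable_cong_sets[OF sB refl])
    have gx: "x \<in> space M \<Longrightarrow> g \<in> borel_measurable (N x)" for x
      using gB by (simp cong: measurable_cong_sets[OF sN refl])
    \<comment> \<open>By Tonelli the iterated integral equals a finite number, so the inner integral
      is finite almost everywhere.\<close>
    have eq: "(\<integral>\<^sup>+x. \<integral>\<^sup>+y. g y \<partial>N x \<partial>M) = ennreal (\<integral>y. g y \<partial>(M \<bind> N))"
      using nn_integral_bind[of "\<lambda>y. ennreal (g y)" B N M] nn_integral_eq_integral[OF g] nn by simp
    have "(\<lambda>x. \<integral>\<^sup>+y. g y \<partial>N x) \<in> borel_measurable M" by measurable
    then have "AE x in M. (\<integral>\<^sup>+y. g y \<partial>N x) \<noteq> \<infinity>"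
      using eq by (intro nn_integral_PInf_AE) auto
    then have ae: "AE x in M. integrable (N x) g"
      using AE_space
    proof eventually_elim
      case (elim x)
      then show ?case
        using gx[of x] nn by (auto intro!: integrableI_nonneg simp: less_top)
    qed
    have "(\<integral>\<^sup>+x. ennreal (\<integral>y. g y \<partial>N x) \<partial>M) = (\<integral>\<^sup>+x. \<integral>\<^sup>+y. g y \<partial>N x \<partial>M)"
      using ae by (intro nn_integral_cong_AE) (auto simp: nn_integral_eq_integral nn)
    with eq have "has_bochner_integral M (\<lambda>x. \<integral>y. g y \<partial>N x) (\<integral>y. g y \<partial>(M \<bind> N))"
      by (intro has_bochner_integral_nn_integral) (auto simp: nn)
    with ae show ?thesis by simp
  qed
  define fp fm where "fp = (\<lambda>y. max 0 (f y))" and "fm = (\<lambda>y. max 0 (- f y))"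
  have f_eq: "f = (\<lambda>y. fp y - fm y)" by (auto simp: fp_def fm_def)
  have int: "integrable (M \<bind> N) fp" "integrable (M \<bind> N) fm"
    using f by (auto simp: fp_def fm_def)
  note p = *[OF int(1)] and m = *[OF int(2)]
  have p': "AE x in M. integrable (N x) fp" "has_bochner_integral M (\<lambda>x. \<integral>y. fp y \<partial>N x) (\<integral>y. fp y \<partial>(M \<bind> N))"
    and m': "AE x in M. integrable (N x) fm" "has_bochner_integral M (\<lambda>x. \<integral>y. fm y \<partial>N x) (\<integral>y. fm y \<partial>(M \<bind> N))"
    using p m by (auto simp: fp_def fm_def)
  show ae: "AE x in M. integrable (N x) f"
    using p'(1) m'(1) by eventually_elim (auto simp: f_eq)
  have fB[measurable]: "f \<in> borel_measurable B"
    using borel_measurable_integrable[OF f] by (simp cong: measurable_cong_sets[OF sB refl])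
  have "has_bochner_integral M (\<lambda>x. (\<integral>y. fp y \<partial>N x) - (\<integral>y. fm y \<partial>N x))
      ((\<integral>y. fp y \<partial>(M \<bind> N)) - (\<integral>y. fm y \<partial>(M \<bind> N)))"
    using p'(2) m'(2) by (rule has_bochner_integral_diff)
  also have "(\<integral>y. fp y \<partial>(M \<bind> N)) - (\<integral>y. fm y \<partial>(M \<bind> N)) = (\<integral>y. f y \<partial>(M \<bind> N))"
    using int by (simp add: f_eq)
  finally have hb: "has_bochner_integral M (\<lambda>x. (\<integral>y. fp y \<partial>N x) - (\<integral>y. fm y \<partial>N x)) (\<integral>y. f y \<partial>(M \<bind> N))" .
  \<comment> \<open>The difference of the two integrals is the integral of \<open>f\<close> only
    where both parts are integrable, hence almost everywhere.\<close>
  have "AE x in M. (\<integral>y. fp y \<partial>N x) - (\<integral>y. fm y \<partial>N x) = (\<integral>y. f y \<partial>N x)"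
    using p'(1) m'(1) by eventually_elim (simp add: f_eq)
  moreover have "(\<lambda>x. \<integral>y. f y \<partial>N x) \<in> borel_measurable M"
    by measurable
  ultimately have "has_bochner_integral M (\<lambda>x. \<integral>y. f y \<partial>N x) (\<integral>y. f y \<partial>(M \<bind> N))"
    using hb has_bochner_integral_cong_AE[OF borel_measurable_has_bochner_integral[OF hb]] by blast
  then show "integrable M (\<lambda>x. \<integral>y. f y \<partial>N x)"
      "(\<integral>y. f y \<partial>(M \<bind> N)) = (\<integral>x. \<integral>y. f y \<partial>N x \<partial>M)"
    by (auto simp: has_bochner_integral_iff)
qed

section \<open>Square-integrable functions on a probability space\<close>

lemma
  assumes "prob_space \<omega>" and f: "f \<in> L2 \<omega>"
  shows L2_measurable: "f \<in> borel_measurable \<omega>"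
    and L2_square_integrable: "integrable \<omega> (\<lambda>x. (f x)\<^sup>2)"
    and L2_integrable: "integrable \<omega> f"
proof -
  interpret prob_space \<omega> by fact
  show "f \<in> borel_measurable \<omega>" "integrable \<omega> (\<lambda>x. (f x)\<^sup>2)"
    using f by (auto simp: L2_def)
  then show "integrable \<omega> f" by (rule square_integrable_imp_integrable)
qed

lemma L2_times_integrable:
  assumes "f \<in> L2 \<omega>" "g \<in> L2 \<omega>"
  shows "integrable \<omega> (\<lambda>x. f x * g x)"
proof (rule Bochner_Integration.integrable_bound)
  show "integrable \<omega> (\<lambda>x. (f x)\<^sup>2 + (g x)\<^sup>2)" "(\<lambda>x. f x * g x) \<in> borel_measurable \<omega>"
    using assms by (auto simp: L2_def)
  have "\<bar>a * b\<bar> \<le> a\<^sup>2 + b\<^sup>2" for a b :: real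
    using sum_squares_bound[of "\<bar>a\<bar>" "\<bar>b\<bar>"] mult_nonneg_nonneg[OF abs_ge_zero abs_ge_zero, of a b]
    unfolding abs_mult power2_abs by linarith
  then show "AE x in \<omega>. norm (f x * g x) \<le> norm ((f x)\<^sup>2 + (g x)\<^sup>2)"
    by simp
qed

lemma L2_minus_const:
  assumes "prob_space \<omega>" "f \<in> L2 \<omega>"
  shows "(\<lambda>x. f x - c) \<in> L2 \<omega>"
proof -
  interpret prob_space \<omega> by fact
  have "integrable \<omega> (\<lambda>x. (f x)\<^sup>2 - 2 * c * f x + c\<^sup>2)"
    using L2_square_integrable[OF assms] L2_integrable[OF assms] by auto
  then show ?thesis
    using L2_measurable[OF assms] by (auto simp: L2_def power2_diff algebra_simps)
qed

text \<open>Nonnegativity of the variance. Used with \<open>M\<close> a kernel measure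
  \<open>K x\<close>, it bounds the square of \<open>kernel_op K f\<close> by the kernel average of
  the square of \<open>f\<close>.\<close>

lemma square_integral_le:
  fixes f :: "'a \<Rightarrow> real"
  assumes "prob_space M" "integrable M f" "integrable M (\<lambda>x. (f x)\<^sup>2)"
  shows "(\<integral>x. f x \<partial>M)\<^sup>2 \<le> (\<integral>x. (f x)\<^sup>2 \<partial>M)"
  using prob_space.variance_eq[OF assms] prob_space.variance_positive[OF assms(1), of f] by simp

section \<open>Kernels with an invariant probability measure\<close>

locale invariant_kernel = prob_space \<omega> for \<omega> :: "'a measure" +
  fixes K :: "'a \<Rightarrow> 'a measure"
  assumes kernel_measurable [measurable]: "K \<in> \<omega> \<rightarrow>\<^sub>M prob_algebra \<omega>"
    and bind_eq: "\<omega> \<bind> K = \<omega>"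
begin

lemma kernel_subprob [measurable]: "K \<in> \<omega> \<rightarrow>\<^sub>M subprob_algebra \<omega>"
  by (rule measurable_prob_algebraD) (rule kernel_measurable)

lemma prob_kernel: "x \<in> space \<omega> \<Longrightarrow> prob_space (K x)"
  using measurable_space[OF kernel_measurable] by (auto simp: space_prob_algebra)

lemma sets_kernel_eq: "x \<in> space \<omega> \<Longrightarrow> sets (K x) = sets \<omega>"
  using measurable_space[OF kernel_measurable] by (auto simp: space_prob_algebra)

lemma kernel_op_measurable: "f \<in> borel_measurable \<omega> \<Longrightarrow> kernel_op K f \<in> borel_measurable \<omega>"
  unfolding kernel_op_def[abs_def]
  by (rule measurable_compose[OF kernel_subprob integral_measurable_subprob_algebra])

text \<open>Rewriting \<omega> as \<open>\<omega> \<bind> K\<close> turns integrability of the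
  square of \<open>f\<close> into integrability under almost every \<open>K x\<close>. The same
  rewriting, with \<open>square_integral_le\<close>, bounds the square of
  \<open>kernel_op K f\<close> by an integrable function.\<close>

lemma
  assumes f: "f \<in> L2 \<omega>"
  shows AE_L2_kernel: "AE x in \<omega>. f \<in> L2 (K x)"
    and kernel_op_L2: "kernel_op K f \<in> L2 \<omega>"
    and integral_kernel_op: "(\<integral>x. kernel_op K f x \<partial>\<omega>) = (\<integral>x. f x \<partial>\<omega>)"
proof -
  note f' = L2_measurable[OF prob_space_axioms f] L2_square_integrable[OF prob_space_axioms f]
    L2_integrable[OF prob_space_axioms f]
  note [measurable] = f'(1)
  have sq: "integrable (\<omega> \<bind> K) (\<lambda>x. (f x)\<^sup>2)" and f1: "integrable (\<omega> \<bind> K) f"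
    using f' by (simp_all add: bind_eq)
  note bd = AE_integrable_bind[OF prob_space_axioms kernel_subprob sq]
    integrable_integral_bind[OF prob_space_axioms kernel_subprob sq]
  show ae: "AE x in \<omega>. f \<in> L2 (K x)"
    using bd(1) AE_space
  proof eventually_elim
    case (elim x)
    then show ?case
      using f'(1) by (simp add: L2_def cong: measurable_cong_sets[OF sets_kernel_eq refl])
  qed
  have "integrable \<omega> (\<lambda>x. (kernel_op K f x)\<^sup>2)"
  proof (rule Bochner_Integration.integrable_bound[OF bd(2)])
    show "(\<lambda>x. (kernel_op K f x)\<^sup>2) \<in> borel_measurable \<omega>"
      using kernel_op_measurable[OF f'(1)] by measurable
    show "AE x in \<omega>. norm ((kernel_op K f x)\<^sup>2) \<le> norm (\<integral>y. (f y)\<^sup>2 \<partial>K x)"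
      using ae AE_space
    proof eventually_elim
      case (elim x)
      then show ?case
        using square_integral_le[OF prob_kernel L2_integrable L2_square_integrable, of x f] prob_kernel[of x]
        by (simp add: kernel_op_def)
    qed
  qed
  then show "kernel_op K f \<in> L2 \<omega>"
    using kernel_op_measurable[OF f'(1)] by (simp add: L2_def)
  show "(\<integral>x. kernel_op K f x \<partial>\<omega>) = (\<integral>x. f x \<partial>\<omega>)"
    using integral_bind_integrable[OF prob_space_axioms kernel_subprob f1] by (simp add: bind_eq kernel_op_def)
qed

text \<open>Removes the centring: \<open>K\<close> fixes constants and preserves the mean, so both
  the squared norm and the inner product drop by exactly \<open>m\<^sup>2\<close>.\<close>

lemma dirichlet_form_eq:
  assumes f: "f \<in> L2 \<omega>"
  shows "dirichlet_form \<omega> K f = (\<integral>x. (f x)\<^sup>2 \<partial>\<omega>) - (\<integral>x. f x * kernel_op K f x \<partial>\<omega>)"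
proof -
  define m where "m = (\<integral>x. f x \<partial>\<omega>)"
  let ?h = "\<lambda>x. f x - m"
  have h: "?h \<in> L2 \<omega>" by (rule L2_minus_const[OF prob_space_axioms f])
  note f' [simp] = L2_square_integrable[OF prob_space_axioms f] L2_integrable[OF prob_space_axioms f]
  note g = kernel_op_L2[OF f]
  note g' [simp] = L2_integrable[OF prob_space_axioms g] L2_times_integrable[OF f g]
  note [measurable] = L2_measurable[OF prob_space_axioms f] L2_measurable[OF prob_space_axioms g]
    L2_measurable[OF prob_space_axioms h] kernel_op_measurable[OF L2_measurable[OF prob_space_axioms h]]
  \<comment> \<open>Where \<open>f\<close> is not integrable under \<open>K x\<close>, neither is
    \<open>f - m\<close>; both integrals are then 0 by default and the identity fails in general.
    Hence the almost-everywhere statement.\<close>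
  have "AE x in \<omega>. ?h x * kernel_op K ?h x = ?h x * (kernel_op K f x - m)"
    using AE_L2_kernel[OF f] AE_space
  proof eventually_elim
    case (elim x)
    interpret K: prob_space "K x" by (rule prob_kernel) fact
    show ?case
      using L2_integrable[OF K.prob_space_axioms elim(1)] by (simp add: kernel_op_def K.prob_space)
  qed
  then have "L2_inner \<omega> ?h (kernel_op K ?h) = (\<integral>x. ?h x * (kernel_op K f x - m) \<partial>\<omega>)"
    unfolding L2_inner_def by (intro integral_cong_AE) auto
  also have "\<dots> = (\<integral>x. (f x * kernel_op K f x - m * kernel_op K f x) - m * f x + m\<^sup>2 \<partial>\<omega>)"
    by (intro Bochner_Integration.integral_cong) (auto simp: algebra_simps power2_eq_square)
  also have "\<dots> = (\<integral>x. f x * kernel_op K f x \<partial>\<omega>) - m\<^sup>2"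
    by (simp add: integral_kernel_op[OF f] m_def[symmetric] prob_space power2_eq_square)
  finally have 1: "L2_inner \<omega> ?h (kernel_op K ?h) = (\<integral>x. f x * kernel_op K f x \<partial>\<omega>) - m\<^sup>2" .
  have "(L2_norm \<omega> ?h)\<^sup>2 = (\<integral>x. (?h x)\<^sup>2 \<partial>\<omega>)"
    by (simp add: L2_norm_def L2_inner_def power2_eq_square)
  also have "\<dots> = (\<integral>x. (f x)\<^sup>2 \<partial>\<omega>) - m\<^sup>2"
    unfolding m_def by (rule variance_eq) simp_all
  finally show ?thesis
    using 1 by (simp add: dirichlet_form_def m_def)
qed

end

section \<open>Finite mixtures of kernels\<close>

text \<open>The Gibbs kernels are given as \<open>measure_of\<close> a raw set function. Recognising
  it as the measure of a bind over the discrete law of the index \<open>i\<close> avoids a separate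
  proof of countable additivity and makes \<open>integral_bind_integrable\<close>
  applicable.\<close>

lemma measure_of_finite_mixture:
  assumes I: "finite I" and p: "\<And>i. i \<in> I \<Longrightarrow> 0 \<le> p i" "(\<Sum>i\<in>I. p i) = 1"
    and K: "\<And>i. i \<in> I \<Longrightarrow> K i \<in> space (prob_algebra Z)"
  shows "measure_of (space Z) (sets Z) (\<lambda>B. \<Sum>i\<in>I. ennreal (p i) * emeasure (K i) B) =
    point_measure I (\<lambda>i. ennreal (p i)) \<bind> K"
proof -
  let ?\<pi> = "point_measure I (\<lambda>i. ennreal (p i))"
  interpret \<pi>: prob_space ?\<pi>
    using p I by (intro prob_space_point_measure) auto
  have Km: "K \<in> ?\<pi> \<rightarrow>\<^sub>M subprob_algebra Z"
    using K by (intro measurable_prob_algebraD) auto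
  have s: "sets (?\<pi> \<bind> K) = sets Z"
    using sets_kernel[OF Km] \<pi>.not_empty by (intro sets_bind) auto
  have e: "emeasure (?\<pi> \<bind> K) B = (\<Sum>i\<in>I. ennreal (p i) * emeasure (K i) B)" if "B \<in> sets Z" for B
    using that emeasure_bind[OF \<pi>.not_empty Km, of B] I by (simp add: nn_integral_point_measure_finite)
  have "measure_of (space Z) (sets Z) (\<lambda>B. \<Sum>i\<in>I. ennreal (p i) * emeasure (K i) B) =
      measure_of (space Z) (sets Z) (emeasure (?\<pi> \<bind> K))"
    by (rule measure_of_eq) (auto simp: e sets.sigma_sets_eq sets.space_closed)
  also have "\<dots> = ?\<pi> \<bind> K"
    using measure_of_of_measure[of "?\<pi> \<bind> K"] by (simp add: s sets_eq_imp_space_eq[OF s])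
  finally show ?thesis .
qed

text \<open>The form is affine in the kernel, and weights of total mass 1 turn an affine dependence
  into an average.\<close>

lemma dirichlet_form_mixture:
  fixes \<omega> :: "'a measure" and f :: "'a \<Rightarrow> real"
  assumes I: "finite I" and p: "\<And>i. i \<in> I \<Longrightarrow> 0 \<le> p i" "(\<Sum>i\<in>I. p i) = 1"
    and K: "\<And>i. i \<in> I \<Longrightarrow> invariant_kernel \<omega> (K i)"
    and T: "\<And>x. x \<in> space \<omega> \<Longrightarrow>
      T x = measure_of (space \<omega>) (sets \<omega>) (\<lambda>B. \<Sum>i\<in>I. ennreal (p i) * emeasure (K i x) B)"
    and f: "f \<in> L2_0 \<omega>"
  shows "dirichlet_form \<omega> T f = (\<Sum>i\<in>I. p i * dirichlet_form \<omega> (K i) f)"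
proof -
  let ?\<pi> = "point_measure I (\<lambda>i. ennreal (p i))"
  interpret \<pi>: prob_space ?\<pi>
    using p I by (intro prob_space_point_measure) auto
  obtain i0 where "i0 \<in> I" using \<pi>.not_empty by (auto simp: space_point_measure)
  then interpret \<omega>: prob_space \<omega> using K invariant_kernel_def by blast
  have fL2: "f \<in> L2 \<omega>" and f0: "(\<integral>x. f x \<partial>\<omega>) = 0" using f by (auto simp: L2_0_def)
  note f' = L2_measurable[OF \<omega>.prob_space_axioms fL2] L2_square_integrable[OF \<omega>.prob_space_axioms fL2]
  have Kx: "K i x \<in> space (prob_algebra \<omega>)" if "i \<in> I" "x \<in> space \<omega>" for i x
    by (rule measurable_space[OF invariant_kernel.kernel_measurable[OF K[OF that(1)]] that(2)])
  have Tx: "T x = ?\<pi> \<bind> (\<lambda>i. K i x)" if "x \<in> space \<omega>" for x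
    unfolding T[OF that] using Kx that by (intro measure_of_finite_mixture[OF I p]) auto
  have Km: "(\<lambda>i. K i x) \<in> ?\<pi> \<rightarrow>\<^sub>M subprob_algebra \<omega>" if "x \<in> space \<omega>" for x
    using Kx that by (intro measurable_prob_algebraD) auto
  have sT: "sets (T x) = sets \<omega>" if "x \<in> space \<omega>" for x
    unfolding Tx[OF that] using sets_kernel[OF Km[OF that]] \<pi>.not_empty by (intro sets_bind) auto
  have [measurable]: "T \<in> \<omega> \<rightarrow>\<^sub>M subprob_algebra \<omega>"
  proof (rule measurable_subprob_algebra)
    show "subprob_space (T x)" if "x \<in> space \<omega>" for x
      unfolding Tx[OF that]
      using subprob_space_bind[OF _ Km[OF that]] \<pi>.subprob_space_axioms by simp
    show "sets (T x) = sets \<omega>" if "x \<in> space \<omega>" for x using sT that .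
    fix A assume A: "A \<in> sets \<omega>"
    have "(\<lambda>x. \<Sum>i\<in>I. ennreal (p i) * emeasure (K i x) A) \<in> borel_measurable \<omega>"
      using measurable_compose[OF invariant_kernel.kernel_subprob[OF K] measurable_emeasure_subprob_algebra[OF A]]
      by (intro borel_measurable_sum borel_measurable_times) auto
    then show "(\<lambda>x. emeasure (T x) A) \<in> borel_measurable \<omega>"
      using emeasure_bind[OF \<pi>.not_empty Km A] I
      by (simp add: Tx nn_integral_point_measure_finite cong: measurable_cong)
  qed
  have Top: "kernel_op T f \<in> borel_measurable \<omega>"
    unfolding kernel_op_def[abs_def] using f'(1) by measurable
  \<comment> \<open>Finitely many null sets are merged, so that \<open>f\<close> is integrable under
    all components at once.\<close>
  have "AE x in \<omega>. \<forall>i\<in>I. f \<in> L2 (K i x)"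
    using invariant_kernel.AE_L2_kernel[OF K fL2] by (intro AE_finite_allI[OF I]) auto
  then have "AE x in \<omega>. f x * kernel_op T f x = (\<Sum>i\<in>I. p i * (f x * kernel_op (K i) f x))"
    using AE_space
  proof eventually_elim
    case (elim x)
    have int: "integrable (K i x) f" if "i \<in> I" for i
      using L2_integrable[of "K i x" f] elim Kx[OF that elim(2)] that by (auto simp: space_prob_algebra)
    have fT: "f \<in> borel_measurable (T x)"
      using f'(1) by (simp cong: measurable_cong_sets[OF sT[OF elim(2)] refl])
    \<comment> \<open>Integrability under the mixture itself: its absolute moment is a finite
      combination of finite ones.\<close>
    have "(\<integral>\<^sup>+y. norm (f y) \<partial>T x) = (\<Sum>i\<in>I. ennreal (p i) * (\<integral>\<^sup>+y. norm (f y) \<partial>K i x))"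
      using f'(1) nn_integral_bind[OF _ Km[OF elim(2)], of "\<lambda>y. ennreal (norm (f y))"] I
      by (simp add: Tx[OF elim(2)] nn_integral_point_measure_finite)
    also have "\<dots> < \<infinity>"
      using int I by (auto simp: integrable_iff_bounded ennreal_mult_less_top)
    finally have "integrable (T x) f" using fT by (simp add: integrable_iff_bounded)
    then have "integrable (?\<pi> \<bind> (\<lambda>i. K i x)) f"
      using elim(2) Tx by simp
    from integral_bind_integrable[OF \<pi>.prob_space_axioms Km[OF elim(2)] this]
    have "kernel_op T f x = (\<Sum>i\<in>I. p i * kernel_op (K i) f x)"
      using I p by (simp add: kernel_op_def Tx[OF elim(2)] lebesgue_integral_point_measure_finite)
    then show ?case by (simp add: sum_distrib_left algebra_simps)
  qed
  moreover have "integrable \<omega> (\<lambda>x. f x * kernel_op (K i) f x)" if "i \<in> I" for i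
    by (rule L2_times_integrable[OF fL2 invariant_kernel.kernel_op_L2[OF K[OF that] fL2]])
  note ii = this
  then have "(\<lambda>x. \<Sum>i\<in>I. p i * (f x * kernel_op (K i) f x)) \<in> borel_measurable \<omega>"
    by (intro borel_measurable_integrable) auto
  ultimately have "(\<integral>x. f x * kernel_op T f x \<partial>\<omega>) = (\<integral>x. (\<Sum>i\<in>I. p i * (f x * kernel_op (K i) f x)) \<partial>\<omega>)"
    using Top f'(1) by (intro integral_cong_AE) auto
  also have "\<dots> = (\<Sum>i\<in>I. p i * (\<integral>x. f x * kernel_op (K i) f x \<partial>\<omega>))"
    using ii by simp
  \<comment> \<open>As \<open>f\<close> has mean zero, the centring in the definition is vacuous and
    the form of \<open>T\<close> unfolds directly.\<close>
  finally have "dirichlet_form \<omega> T f =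
      (\<integral>x. (f x)\<^sup>2 \<partial>\<omega>) - (\<Sum>i\<in>I. p i * (\<integral>x. f x * kernel_op (K i) f x \<partial>\<omega>))"
    by (simp add: dirichlet_form_def f0 L2_norm_def L2_inner_def power2_eq_square)
  also have "\<dots> = (\<Sum>i\<in>I. p i) * (\<integral>x. (f x)\<^sup>2 \<partial>\<omega>) - (\<Sum>i\<in>I. p i * (\<integral>x. f x * kernel_op (K i) f x \<partial>\<omega>))"
    by (simp add: p(2))
  also have "\<dots> = (\<Sum>i\<in>I. p i * dirichlet_form \<omega> (K i) f)"
    using invariant_kernel.dirichlet_form_eq[OF K fL2]
    by (simp add: sum_distrib_right sum_subtractf[symmetric] right_diff_distrib)
  finally show ?thesis .
qed

section \<open>Variance and gap on a single fibre\<close>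

text \<open>A fresh draw from \<omega> sends a centred function to its mean 0, so the inner product
  term vanishes and the variance remains.\<close>

lemma dirichlet_form_exact:
  assumes "prob_space \<omega>" "integrable \<omega> g"
  shows "dirichlet_form \<omega> (\<lambda>_. \<omega>) g = (L2_norm \<omega> (\<lambda>x. g x - (\<integral>z. g z \<partial>\<omega>)))\<^sup>2"
proof -
  interpret prob_space \<omega> by fact
  show ?thesis
    using assms by (simp add: dirichlet_form_def Let_def L2_inner_def kernel_op_def prob_space)
qed

lemma dirichlet_form_minus_mean:
  assumes "prob_space \<omega>" "integrable \<omega> g"
  shows "dirichlet_form \<omega> K (\<lambda>x. g x - (\<integral>z. g z \<partial>\<omega>)) = dirichlet_form \<omega> K g"
proof -
  interpret prob_space \<omega> by fact
  show ?thesis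
    using assms by (simp add: dirichlet_form_def Let_def prob_space)
qed

lemma dirichlet_form_gap:
  assumes "prob_space \<omega>" and g: "g \<in> L2 \<omega>"
    and gap: "\<And>h. h \<in> L2_0 \<omega> \<Longrightarrow> \<not> (AE a in \<omega>. h a = 0) \<Longrightarrow>
      c1 \<le> dirichlet_form \<omega> K h / (L2_norm \<omega> h)\<^sup>2 \<and> dirichlet_form \<omega> K h / (L2_norm \<omega> h)\<^sup>2 \<le> c2"
  shows "c1 * dirichlet_form \<omega> (\<lambda>_. \<omega>) g \<le> dirichlet_form \<omega> K g"
    and "dirichlet_form \<omega> K g \<le> c2 * dirichlet_form \<omega> (\<lambda>_. \<omega>) g"
proof -
  interpret prob_space \<omega> by fact
  let ?h = "\<lambda>x. g x - (\<integral>z. g z \<partial>\<omega>)"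
  note int = L2_integrable[OF prob_space_axioms g]
  have hL2: "?h \<in> L2 \<omega>" by (rule L2_minus_const[OF prob_space_axioms g])
  have h: "?h \<in> L2_0 \<omega>" using hL2 int by (simp add: L2_0_def prob_space)
  have nrm: "(L2_norm \<omega> ?h)\<^sup>2 = (\<integral>x. (?h x)\<^sup>2 \<partial>\<omega>)"
    by (simp add: L2_norm_def L2_inner_def power2_eq_square)
  have "c1 * (L2_norm \<omega> ?h)\<^sup>2 \<le> dirichlet_form \<omega> K ?h \<and> dirichlet_form \<omega> K ?h \<le> c2 * (L2_norm \<omega> ?h)\<^sup>2"
  \<comment> \<open>The gap says nothing about the zero element of \<open>L2_0\<close>; there the
    norm and the form both vanish. Otherwise the norm is positive and the quotient can be
    cleared.\<close>
  proof (cases "AE a in \<omega>. ?h a = 0")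
    case True
    then have "(L2_norm \<omega> ?h)\<^sup>2 = 0" unfolding nrm by (intro integral_eq_zero_AE) auto
    moreover have "L2_inner \<omega> ?h (kernel_op K ?h) = 0"
      unfolding L2_inner_def using True by (intro integral_eq_zero_AE) auto
    moreover have "(\<integral>x. ?h x \<partial>\<omega>) = 0" using h by (simp add: L2_0_def)
    ultimately show ?thesis by (simp add: dirichlet_form_def Let_def)
  next
    case False
    then have "(L2_norm \<omega> ?h)\<^sup>2 \<noteq> 0"
      unfolding nrm using integral_nonneg_eq_0_iff_AE[OF L2_square_integrable[OF prob_space_axioms hL2]]
      by simp
    then have "0 < (L2_norm \<omega> ?h)\<^sup>2" by simp
    then show ?thesis using gap[OF h False] by (simp add: field_simps)
  qed
  then show "c1 * dirichlet_form \<omega> (\<lambda>_. \<omega>) g \<le> dirichlet_form \<omega> K g"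
    "dirichlet_form \<omega> K g \<le> c2 * dirichlet_form \<omega> (\<lambda>_. \<omega>) g"
    unfolding dirichlet_form_exact[OF prob_space_axioms int]
      dirichlet_form_minus_mean[OF prob_space_axioms int] by simp_all
qed

lemma reversible_imp_invariant_kernel:
  assumes \<omega>: "prob_space \<omega>" and K: "K \<in> \<omega> \<rightarrow>\<^sub>M prob_algebra \<omega>" and rev: "reversible_wrt K \<omega>"
  shows "invariant_kernel \<omega> K"
proof -
  interpret prob_space \<omega> by fact
  have Ks: "K \<in> \<omega> \<rightarrow>\<^sub>M subprob_algebra \<omega>" by (rule measurable_prob_algebraD[OF K])
  have s: "sets (\<omega> \<bind> K) = sets \<omega>"
    using sets_kernel[OF Ks] not_empty by (intro sets_bind) auto
  have "emeasure (\<omega> \<bind> K) B = emeasure \<omega> B" if B: "B \<in> sets \<omega>" for B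
  proof -
    have "emeasure (\<omega> \<bind> K) B = (\<integral>\<^sup>+x. emeasure (K x) B \<partial>\<omega>)"
      by (rule emeasure_bind[OF not_empty Ks B])
    also have "\<dots> = (\<integral>\<^sup>+x\<in>space \<omega>. emeasure (K x) B \<partial>\<omega>)"
      by (intro nn_integral_cong) simp
    \<comment> \<open>Reversibility with the whole space as one of the two sets.\<close>
    also have "\<dots> = (\<integral>\<^sup>+x\<in>B. emeasure (K x) (space \<omega>) \<partial>\<omega>)"
      using rev B by (auto simp: reversible_wrt_def)
    also have "\<dots> = (\<integral>\<^sup>+x. indicator B x \<partial>\<omega>)"
      using measurable_space[OF K] by (intro nn_integral_cong) (simp add: in_space_prob_algebra)
    finally show ?thesis using B by simp
  qed
  then show ?thesis
    using K s by unfold_locales (auto intro!: measure_eqI)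
qed

section \<open>Inserting a component into a point of the product\<close>

lemma pair_measure_return:
  assumes "prob_space M" and y: "y \<in> space N"
  shows "M \<Otimes>\<^sub>M return N y = distr M (M \<Otimes>\<^sub>M N) (\<lambda>x. (x, y))"
proof (rule measure_eqI)
  interpret R: prob_space "return N y" by (rule prob_space_return[OF y])
  show "sets (M \<Otimes>\<^sub>M return N y) = sets (distr M (M \<Otimes>\<^sub>M N) (\<lambda>x. (x, y)))"
    by (simp cong: sets_pair_measure_cong)
  fix A assume "A \<in> sets (M \<Otimes>\<^sub>M return N y)"
  moreover have s: "sets (M \<Otimes>\<^sub>M return N y) = sets (M \<Otimes>\<^sub>M N)"
    by (simp cong: sets_pair_measure_cong)
  ultimately have A: "A \<in> sets (M \<Otimes>\<^sub>M return N y)" "A \<in> sets (M \<Otimes>\<^sub>M N)" by auto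
  have m: "(\<lambda>x. (x, y)) \<in> M \<rightarrow>\<^sub>M M \<Otimes>\<^sub>M N" using y by measurable
  have "emeasure (M \<Otimes>\<^sub>M return N y) A = (\<integral>\<^sup>+x. emeasure (return N y) (Pair x -` A) \<partial>M)"
    by (rule R.emeasure_pair_measure_alt[OF A(1)])
  also have "\<dots> = (\<integral>\<^sup>+x. indicator ((\<lambda>x. (x, y)) -` A \<inter> space M) x \<partial>M)"
    using sets_Pair1[OF A(2)] by (intro nn_integral_cong) (auto simp: indicator_def)
  also have "\<dots> = emeasure (distr M (M \<Otimes>\<^sub>M N) (\<lambda>x. (x, y))) A"
    using measurable_sets[OF m A(2)] by (simp add: emeasure_distr[OF m A(2)])
  finally show "emeasure (M \<Otimes>\<^sub>M return N y) A = emeasure (distr M (M \<Otimes>\<^sub>M N) (\<lambda>x. (x, y))) A" .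
qed

lemma measurable_upd_comp:
  assumes "i \<in> {1..n}"
  shows "(\<lambda>(a, z). z(i := a)) \<in> borel_of (X i) \<Otimes>\<^sub>M prod_space_minus n X i \<rightarrow>\<^sub>M prod_space n X"
  unfolding prod_space_def prod_space_minus_def split_beta'
  using assms by (intro measurable_fun_upd[where J="{1..n} - {i}"]) auto

lemma measurable_remove_comp:
  "remove_comp n i \<in> prod_space n X \<rightarrow>\<^sub>M prod_space_minus n X i"
  unfolding remove_comp_def[abs_def] prod_space_def prod_space_minus_def
  by (rule measurable_restrict_subset) auto

text \<open>The form for computing: the second factor is a point mass, so the product measure is an
  image of \<nu> alone. Measurability in the parameters is instead read off the definition, a
  composition of measurable kernels.\<close>

lemma insert_comp_eq_distr:
  assumes i: "i \<in> {1..n}" and \<nu>: "\<nu> \<in> space (prob_algebra (borel_of (X i)))"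
    and y: "y \<in> space (prod_space_minus n X i)"
  shows "insert_comp n X i \<nu> y = distr \<nu> (prod_space n X) (\<lambda>a. y(i := a))"
proof -
  have p: "prob_space \<nu>" and s: "sets \<nu> = sets (borel_of (X i))"
    using \<nu> by (auto simp: space_prob_algebra)
  have m: "(\<lambda>(a, z). z(i := a)) \<in> \<nu> \<Otimes>\<^sub>M prod_space_minus n X i \<rightarrow>\<^sub>M prod_space n X"
    using measurable_upd_comp[OF i] by (simp cong: measurable_cong_sets sets_pair_measure_cong add: s)
  show ?thesis
    unfolding insert_comp_def pair_measure_return[OF p y]
    using distr_distr[OF m, of "\<lambda>x. (x, y)" \<nu>] y by (simp add: o_def)
qed

lemma measurable_insert_comp:
  assumes i: "i \<in> {1..n}" and \<kappa>: "\<kappa> \<in> N \<rightarrow>\<^sub>M prob_algebra (borel_of (X i))"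
    and r: "r \<in> N \<rightarrow>\<^sub>M prod_space_minus n X i"
  shows "(\<lambda>x. insert_comp n X i (\<kappa> x) (r x)) \<in> N \<rightarrow>\<^sub>M prob_algebra (prod_space n X)"
  unfolding insert_comp_def
  by (rule measurable_compose[OF measurable_pair_prob[OF \<kappa>
          measurable_compose[OF r measurable_return_prob_space]]
        measurable_distr_prob_space[OF measurable_upd_comp[OF i]]])

section \<open>Updating one component\<close>

text \<open>The gap is deliberately kept out, so that the hybrid and the exact update are both
  instances over the same \<mu> and \<open>P\<close>.\<close>

locale gibbs_component =
  fixes n i :: nat and X :: "nat \<Rightarrow> 'a topology" and \<mu> :: "(nat \<Rightarrow> 'a) measure"
    and P :: "(nat \<Rightarrow> 'a) \<Rightarrow> 'a measure" and Q :: "(nat \<Rightarrow> 'a) \<Rightarrow> 'a \<Rightarrow> 'a measure"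
  assumes i: "i \<in> {1..n}"
    and prob_target: "prob_space \<mu>" and sets_target: "sets \<mu> = sets (prod_space n X)"
    and conditional: "conditional_distribution \<mu> (borel_of (X i)) (\<lambda>x. x i)
        (prod_space_minus n X i) (remove_comp n i) P"
    and fibre_kernel: "\<And>y. y \<in> space (prod_space_minus n X i) \<Longrightarrow>
      markov_kernel (borel_of (X i)) (Q y) \<and> reversible_wrt (Q y) (P y)"
    and fibre_measurable: "\<And>A. A \<in> sets (borel_of (X i)) \<Longrightarrow>
      (\<lambda>x. measure (Q (remove_comp n i x) (x i)) A) \<in> borel_measurable (prod_space n X)"
begin

sublocale prob_space \<mu> by (rule prob_target)

abbreviation "S \<equiv> borel_of (X i)"
abbreviation "Y \<equiv> prod_space_minus n X i"
abbreviation "Z \<equiv> prod_space n X"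
abbreviation "r \<equiv> remove_comp n i"
abbreviation "\<nu> \<equiv> marginal_minus n X \<mu> i"
abbreviation "K \<equiv> \<lambda>x. insert_comp n X i (Q (r x) (x i)) (r x)"
text \<open>The conditional law of the whole point given that its other components are
  \<open>y\<close>: \<open>P y\<close> carried to the fibre over \<open>y\<close>.\<close>

abbreviation "R \<equiv> \<lambda>y. insert_comp n X i (P y) y"

lemma space_target: "space \<mu> = space Z"
  by (rule sets_eq_imp_space_eq) (rule sets_target)

lemma remove_measurable: "r \<in> \<mu> \<rightarrow>\<^sub>M Y"
  using measurable_remove_comp by (simp cong: measurable_cong_sets add: sets_target)

lemma comp_measurable: "(\<lambda>x. x i) \<in> Z \<rightarrow>\<^sub>M S"
  using i unfolding prod_space_def by measurable

lemma sets_marginal: "sets \<nu> = sets Y" and space_marginal: "space \<nu> = space Y"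
  by (simp_all add: marginal_minus_def)

lemma prob_marginal: "prob_space \<nu>"
  unfolding marginal_minus_def by (rule prob_space_distr[OF remove_measurable])

lemma P_measurable: "P \<in> Y \<rightarrow>\<^sub>M prob_algebra S"
  using conditional by (simp add: conditional_distribution_def)

lemma P_space: "y \<in> space Y \<Longrightarrow> P y \<in> space (prob_algebra S)"
  by (rule measurable_space[OF P_measurable])

lemma P_prob: "y \<in> space Y \<Longrightarrow> prob_space (P y)" and P_sets: "y \<in> space Y \<Longrightarrow> sets (P y) = sets S"
  using P_space by (auto simp: space_prob_algebra)

lemma Q_measurable: "y \<in> space Y \<Longrightarrow> Q y \<in> S \<rightarrow>\<^sub>M prob_algebra S"
  using fibre_kernel by (simp add: markov_kernel_def)

lemma Q_space: "y \<in> space Y \<Longrightarrow> a \<in> space S \<Longrightarrow> Q y a \<in> space (prob_algebra S)"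
  using measurable_space[OF Q_measurable] .

lemma fibre_invariant: "invariant_kernel (P y) (Q y)" if y: "y \<in> space Y"
proof (rule reversible_imp_invariant_kernel)
  have "prob_algebra (P y) = prob_algebra S"
    using P_sets[OF y] by (simp add: prob_algebra_def cong: subprob_algebra_cong)
  then show "Q y \<in> P y \<rightarrow>\<^sub>M prob_algebra (P y)"
    using Q_measurable[OF y] by (simp cong: measurable_cong_sets add: P_sets[OF y])
qed (use P_prob fibre_kernel y in auto)

lemma remove_space: "x \<in> space Z \<Longrightarrow> r x \<in> space Y"
  by (rule measurable_space[OF measurable_remove_comp])

lemma upd_measurable: "y \<in> space Y \<Longrightarrow> (\<lambda>a. y(i := a)) \<in> S \<rightarrow>\<^sub>M Z"
  using measurable_compose[OF measurable_Pair1' measurable_upd_comp[OF i]]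
    measurable_Pair2'[of y Y S] measurable_compose[OF measurable_Pair2' measurable_upd_comp[OF i, of X]]
  by simp

lemma remove_upd: "y \<in> space Y \<Longrightarrow> r (y(i := a)) = y"
  by (auto simp: remove_comp_def prod_space_minus_def space_PiM PiE_def extensional_def fun_eq_iff)

lemma R_measurable: "R \<in> \<nu> \<rightarrow>\<^sub>M prob_algebra Z"
  using measurable_insert_comp[OF i P_measurable measurable_ident_sets[OF refl]]
  by (simp cong: measurable_cong_sets add: sets_marginal)

lemma R_eq: "y \<in> space Y \<Longrightarrow> R y = distr (P y) Z (\<lambda>a. y(i := a))"
  by (intro insert_comp_eq_distr i P_space)

text \<open>That \<open>Q y\<close> is a kernel for each fixed \<open>y\<close> gives no
  measurability in \<open>y\<close>. This comes from \<open>fibre_measurable\<close>, since the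
  sigma-algebra on measures is generated by the evaluations at sets.\<close>

lemma joint_kernel_measurable: "(\<lambda>x. Q (r x) (x i)) \<in> Z \<rightarrow>\<^sub>M prob_algebra S"
proof (rule measurable_prob_algebraI)
  have Qx: "Q (r x) (x i) \<in> space (prob_algebra S)" if "x \<in> space Z" for x
    using Q_space[OF remove_space[OF that] measurable_space[OF comp_measurable that]] .
  show "prob_space (Q (r x) (x i))" if "x \<in> space Z" for x
    using Qx[OF that] by (simp add: space_prob_algebra)
  show "(\<lambda>x. Q (r x) (x i)) \<in> Z \<rightarrow>\<^sub>M subprob_algebra S"
  proof (rule measurable_subprob_algebra)
    show "subprob_space (Q (r x) (x i))" "sets (Q (r x) (x i)) = sets S" if "x \<in> space Z" for x
      using Qx[OF that] by (auto simp: space_prob_algebra prob_space_imp_subprob_space)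
    fix A assume A: "A \<in> sets S"
    have "emeasure (Q (r x) (x i)) A = ennreal (measure (Q (r x) (x i)) A)" if "x \<in> space Z" for x
      using Qx[OF that]
      by (intro finite_measure.emeasure_eq_measure) (auto simp: space_prob_algebra prob_space.finite_measure)
    then show "(\<lambda>x. emeasure (Q (r x) (x i)) A) \<in> borel_measurable Z"
      using fibre_measurable[OF A] by (simp cong: measurable_cong)
  qed
qed

lemma K_measurable: "K \<in> Z \<rightarrow>\<^sub>M prob_algebra Z"
  by (rule measurable_insert_comp[OF i joint_kernel_measurable measurable_remove_comp])

text \<open>Removing component \<open>i\<close> from \<open>y(i := a)\<close> gives back
  \<open>y\<close>, so \<open>K\<close> never leaves the fibre over \<open>y\<close> and acts there
  as \<open>Q y\<close>.\<close>

lemma K_upd: "y \<in> space Y \<Longrightarrow> a \<in> space S \<Longrightarrow> K (y(i := a)) = distr (Q y a) Z (\<lambda>a. y(i := a))"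
  using insert_comp_eq_distr[OF i, of "Q y a" X y] by (simp add: remove_upd Q_space)

text \<open>Rectangles determine a finite measure on the product, and on a rectangle the claim is
  the defining equation of \<open>conditional_distribution\<close>.\<close>

lemma disintegration: "\<nu> \<bind> R = \<mu>"
proof (rule measure_eqI_PiM_finite)
  note Rs = measurable_prob_algebraD[OF R_measurable]
  have ne: "space \<nu> \<noteq> {}" using prob_space.not_empty[OF prob_marginal] .
  have s: "sets (\<nu> \<bind> R) = sets Z"
    using sets_kernel[OF Rs] ne by (intro sets_bind) auto
  then show "sets (\<nu> \<bind> R) = sets (\<Pi>\<^sub>M j\<in>{1..n}. borel_of (X j))"
    "sets \<mu> = sets (\<Pi>\<^sub>M j\<in>{1..n}. borel_of (X j))"
    using sets_target by (simp_all add: prod_space_def)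
  fix A assume A: "\<And>j. j \<in> {1..n} \<Longrightarrow> A j \<in> sets (borel_of (X j))"
  let ?B = "Pi\<^sub>E {1..n} A" and ?C = "Pi\<^sub>E ({1..n} - {i}) A"
  have B: "?B \<in> sets Z" unfolding prod_space_def using A by (intro sets_PiM_I_finite) auto
  have C: "?C \<in> sets Y" unfolding prod_space_minus_def using A by (intro sets_PiM_I_finite) auto
  have mem: "y(i := a) \<in> ?B \<longleftrightarrow> a \<in> A i \<and> y \<in> ?C" if "y \<in> space Y" for y a
    using that i by (auto simp: PiE_def Pi_def extensional_def prod_space_minus_def space_PiM)
  have "emeasure (\<nu> \<bind> R) ?B = (\<integral>\<^sup>+y. emeasure (R y) ?B \<partial>\<nu>)"
    by (rule emeasure_bind[OF ne Rs B])
  also have "\<dots> = (\<integral>\<^sup>+y\<in>?C. emeasure (P y) (A i) \<partial>\<nu>)"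
  proof (rule nn_integral_cong)
    fix y assume "y \<in> space \<nu>"
    then have y: "y \<in> space Y" by (simp add: space_marginal)
    have m: "(\<lambda>a. y(i := a)) \<in> P y \<rightarrow>\<^sub>M Z"
      using upd_measurable[OF y] by (simp cong: measurable_cong_sets add: P_sets[OF y])
    \<comment> \<open>The rectangle meets the fibre over \<open>y\<close> in all of
      \<open>A i\<close> or not at all, which produces the indicator of \<open>?C\<close>.\<close>
    have "(\<lambda>a. y(i := a)) -` ?B \<inter> space (P y) = (if y \<in> ?C then A i else {})"
      using sets.sets_into_space[OF A[OF i]] sets_eq_imp_space_eq[OF P_sets[OF y]] mem[OF y] by auto
    then show "emeasure (R y) ?B = emeasure (P y) (A i) * indicator ?C y"
      unfolding R_eq[OF y] emeasure_distr[OF m B] by simp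
  qed
  also have "\<dots> = emeasure \<mu> {x \<in> space \<mu>. x i \<in> A i \<and> r x \<in> ?C}"
    using conditional A[OF i] C by (simp add: conditional_distribution_def marginal_minus_def)
  also have "{x \<in> space \<mu>. x i \<in> A i \<and> r x \<in> ?C} = ?B"
  proof -
    have "?B \<subseteq> space \<mu>" using sets.sets_into_space[OF B] by (simp add: space_target)
    moreover have "x \<in> ?B \<longleftrightarrow> x i \<in> A i \<and> r x \<in> ?C" if "x \<in> space \<mu>" for x
    proof -
      have "x = (r x)(i := x i)"
        using that i by (auto simp: space_target prod_space_def space_PiM PiE_def extensional_def
            remove_comp_def fun_eq_iff)
      then show ?thesis using mem[OF remove_space, of x "x i"] that space_target by metis
    qed
    ultimately show ?thesis by blast
  qed
  finally show "emeasure (\<nu> \<bind> R) ?B = emeasure \<mu> ?B" .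
next
  \<comment> \<open>The uniqueness rule also asks for a countable cover by rectangles of finite
    mass; the whole space, repeated, serves.\<close>
  show "range (\<lambda>_::nat. space Z) \<subseteq> prod_algebra {1..n} (\<lambda>j. borel_of (X j))"
    unfolding prod_space_def space_PiM by (auto intro!: prod_algebraI_finite)
  show "(\<Union>k::nat. space Z) = space (\<Pi>\<^sub>M j\<in>{1..n}. borel_of (X j))"
    by (simp add: prod_space_def)
  have "prob_space (\<nu> \<bind> R)"
    using prob_space_bind'[OF _ R_measurable] prob_marginal by (simp add: space_prob_algebra)
  then show "emeasure (\<nu> \<bind> R) (space Z) \<noteq> \<infinity>" for k :: nat
    using finite_measure.emeasure_finite prob_space.finite_measure by fastforce
qed auto

lemma fibre_bind: "R y \<bind> K = R y" if y: "y \<in> space Y"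
proof -
  interpret Qy: invariant_kernel "P y" "Q y" by (rule fibre_invariant[OF y])
  have sp: "space (P y) = space S" by (rule sets_eq_imp_space_eq[OF P_sets[OF y]])
  have mP: "(\<lambda>a. y(i := a)) \<in> P y \<rightarrow>\<^sub>M Z"
    using upd_measurable[OF y] by (simp cong: measurable_cong_sets add: P_sets[OF y])
  have "R y \<bind> K = P y \<bind> (\<lambda>a. K (y(i := a)))"
    unfolding R_eq[OF y]
    by (rule bind_distr[OF mP measurable_prob_algebraD[OF K_measurable] Qy.not_empty])
  also have "\<dots> = P y \<bind> (\<lambda>a. distr (Q y a) Z (\<lambda>a. y(i := a)))"
    using K_upd[OF y] by (intro bind_cong) (simp_all add: sp)
  also have "\<dots> = distr (P y \<bind> Q y) Z (\<lambda>a. y(i := a))"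
    by (rule distr_bind[symmetric, OF Qy.kernel_subprob Qy.not_empty mP])
  finally show ?thesis by (simp add: Qy.bind_eq R_eq[OF y])
qed

text \<open>By associativity of bind, invariance on every fibre (\<open>fibre_bind\<close>) survives
  averaging over the fibres.\<close>

lemma invariant: "invariant_kernel \<mu> K"
proof
  have "prob_algebra \<mu> = prob_algebra Z"
    using sets_target by (simp add: prob_algebra_def cong: subprob_algebra_cong)
  then show "K \<in> \<mu> \<rightarrow>\<^sub>M prob_algebra \<mu>"
    using K_measurable by (simp cong: measurable_cong_sets add: sets_target)
  have "\<mu> \<bind> K = (\<nu> \<bind> R) \<bind> K" by (simp add: disintegration)
  also have "\<dots> = \<nu> \<bind> (\<lambda>y. R y \<bind> K)"
    by (rule bind_assoc[OF measurable_prob_algebraD[OF R_measurable] measurable_prob_algebraD[OF K_measurable]])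
  also have "\<dots> = \<nu> \<bind> R"
    by (intro bind_cong) (simp_all add: space_marginal fibre_bind)
  finally show "\<mu> \<bind> K = \<mu>" by (simp add: disintegration)
qed

lemma upd_fibre_measurable: "y \<in> space Y \<Longrightarrow> (\<lambda>a. y(i := a)) \<in> P y \<rightarrow>\<^sub>M Z"
  using upd_measurable by (simp cong: measurable_cong_sets add: P_sets)

text \<open>The square of \<open>f\<close> is integrable under the mixture
  \<open>\<nu> \<bind> R\<close>, hence under almost every \<open>R y\<close>, which is the image of
  \<open>P y\<close>.\<close>

lemma AE_fibre_L2:
  assumes f: "f \<in> L2 \<mu>"
  shows "AE y in \<nu>. (\<lambda>a. f (y(i := a))) \<in> L2 (P y)"
proof -
  have fm: "f \<in> borel_measurable Z"
    using f by (simp add: L2_def cong: measurable_cong_sets[OF sets_target refl])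
  have "integrable (\<nu> \<bind> R) (\<lambda>x. (f x)\<^sup>2)"
    using f by (simp add: L2_def disintegration)
  then have "AE y in \<nu>. integrable (R y) (\<lambda>x. (f x)\<^sup>2)"
    by (rule AE_integrable_bind[OF prob_marginal measurable_prob_algebraD[OF R_measurable]])
  then show ?thesis
    using AE_space
  proof eventually_elim
    case (elim y)
    then have y: "y \<in> space Y" by (simp add: space_marginal)
    have "(\<lambda>a. f (y(i := a))) \<in> borel_measurable (P y)"
      by (rule measurable_compose[OF upd_fibre_measurable[OF y] fm])
    then show ?case
      using elim(1) fm
      by (simp add: L2_def R_eq[OF y] integrable_distr_eq[OF upd_fibre_measurable[OF y]])
  qed
qed

text \<open>The fibrewise Dirichlet form is only known to agree almost everywhere with a measurable
  function of the fibre, because \<open>dirichlet_form\<close> takes junk values on fibres where \<open>f\<close> is not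
  square integrable.\<close>

lemma dirichlet_form_disintegrate:
  assumes f: "f \<in> L2 \<mu>"
  obtains D where "integrable \<nu> D" and "dirichlet_form \<mu> K f = (\<integral>y. D y \<partial>\<nu>)"
    and "AE y in \<nu>. D y = dirichlet_form (P y) (Q y) (\<lambda>a. f (y(i := a)))"
proof -
  interpret K: invariant_kernel \<mu> K by (rule invariant)
  note Rs = measurable_prob_algebraD[OF R_measurable]
  let ?g = "\<lambda>y a. f (y(i := a))"
  let ?u = "\<lambda>x. (f x)\<^sup>2" and ?v = "\<lambda>x. f x * kernel_op K f x"
  define D where "D = (\<lambda>y. (\<integral>x. ?u x \<partial>R y) - (\<integral>x. ?v x \<partial>R y))"
  have fm: "f \<in> borel_measurable Z"
    using f by (simp add: L2_def cong: measurable_cong_sets[OF sets_target refl])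
  have Km: "kernel_op K f \<in> borel_measurable Z"
    using K.kernel_op_measurable[of f] f
    by (simp add: L2_def cong: measurable_cong_sets[OF sets_target refl])
  have u: "integrable (\<nu> \<bind> R) ?u" and v: "integrable (\<nu> \<bind> R) ?v"
    unfolding disintegration
    using f L2_times_integrable[OF f K.kernel_op_L2[OF f]] by (auto simp: L2_def)
  note uv = integrable_integral_bind[OF prob_marginal Rs u] integrable_integral_bind[OF prob_marginal Rs v]
  have "dirichlet_form \<mu> K f = (\<integral>x. ?u x \<partial>(\<nu> \<bind> R)) - (\<integral>x. ?v x \<partial>(\<nu> \<bind> R))"
    unfolding disintegration by (rule K.dirichlet_form_eq[OF f])
  also have "\<dots> = (\<integral>y. D y \<partial>\<nu>)"
    using uv by (simp add: D_def integral_bind_integrable[OF prob_marginal Rs u]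
        integral_bind_integrable[OF prob_marginal Rs v])
  finally have D_int: "dirichlet_form \<mu> K f = (\<integral>y. D y \<partial>\<nu>)" .
  \<comment> \<open>A change of variables in the outer and the inner integral. It holds on every
    fibre, since \<open>integral_distr\<close> needs only measurability.\<close>
  have eqv: "(\<integral>x. ?v x \<partial>R y) = (\<integral>a. ?g y a * kernel_op (Q y) (?g y) a \<partial>P y)" if y: "y \<in> space Y" for y
  proof -
    have "(\<integral>x. ?v x \<partial>R y) = (\<integral>a. ?g y a * kernel_op K f (y(i := a)) \<partial>P y)"
      using fm Km by (simp add: R_eq[OF y] integral_distr[OF upd_fibre_measurable[OF y]])
    also have "\<dots> = (\<integral>a. ?g y a * kernel_op (Q y) (?g y) a \<partial>P y)"
    proof (intro Bochner_Integration.integral_cong refl)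
      fix a assume "a \<in> space (P y)"
      then have a: "a \<in> space S" using sets_eq_imp_space_eq[OF P_sets[OF y]] by simp
      have sQ: "sets (Q y a) = sets S" using Q_space[OF y a] by (simp add: space_prob_algebra)
      have "(\<lambda>a. y(i := a)) \<in> Q y a \<rightarrow>\<^sub>M Z"
        using upd_measurable[OF y] by (simp cong: measurable_cong_sets add: sQ)
      then show "?g y a * kernel_op K f (y(i := a)) = ?g y a * kernel_op (Q y) (?g y) a"
        using fm unfolding kernel_op_def K_upd[OF y a] by (simp add: integral_distr)
    qed
    finally show ?thesis .
  qed
  have equ: "(\<integral>x. ?u x \<partial>R y) = (\<integral>a. (?g y a)\<^sup>2 \<partial>P y)" if y: "y \<in> space Y" for y
    using fm by (simp add: R_eq[OF y] integral_distr[OF upd_fibre_measurable[OF y]])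
  \<comment> \<open>Only here must the section be square integrable: \<open>D y\<close> is the
    uncentred expression, and \<open>dirichlet_form_eq\<close> on the fibre identifies it with the
    form.\<close>
  have "AE y in \<nu>. D y = dirichlet_form (P y) (Q y) (?g y)"
    using AE_fibre_L2[OF f] AE_space
  proof eventually_elim
    case (elim y)
    then have y: "y \<in> space Y" by (simp add: space_marginal)
    show ?case
      using invariant_kernel.dirichlet_form_eq[OF fibre_invariant[OF y] elim(1)] equ[OF y] eqv[OF y]
      by (simp add: D_def)
  qed
  moreover have "integrable \<nu> D" using uv by (simp add: D_def)
  ultimately show thesis using that D_int by blast
qed

end

section \<open>Comparison of the two samplers\<close>

text \<open>Resampling is reversible because two independent draws from \<open>P y\<close> are
  exchangeable: both sides are the product of the masses of the two sets.\<close>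

lemma gibbs_component_exact:
  assumes "gibbs_component n i X \<mu> P Q"
  shows "gibbs_component n i X \<mu> P (\<lambda>y a. P y)"
proof -
  interpret gibbs_component n i X \<mu> P Q by fact
  show ?thesis
  proof
    fix y assume y: "y \<in> space Y"
    show "markov_kernel S (\<lambda>a. P y) \<and> reversible_wrt (\<lambda>a. P y) (P y)"
      using P_space[OF y]
      by (auto simp: markov_kernel_def reversible_wrt_def nn_integral_cmult_indicator
          intro: mult.commute)
  next
    fix A assume "A \<in> sets S"
    then show "(\<lambda>x. measure (P (r x)) A) \<in> borel_measurable Z"
      by (intro measurable_compose[OF measurable_compose[OF measurable_remove_comp P_measurable]
            measurable_measure_prob_algebra])
  qed (use i prob_target sets_target conditional in auto)
qed

lemma gibbs_component_gap:
  assumes "gibbs_component n i X \<mu> P Q"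
    and gap: "AE y in marginal_minus n X \<mu> i.
        \<forall>g\<in>L2_0 (P y). \<not> (AE a in P y. g a = 0) \<longrightarrow>
          c1 \<le> dirichlet_form (P y) (Q y) g / (L2_norm (P y) g)\<^sup>2 \<and>
          dirichlet_form (P y) (Q y) g / (L2_norm (P y) g)\<^sup>2 \<le> c2"
    and f: "f \<in> L2 \<mu>"
  defines "E \<equiv> dirichlet_form \<mu> (\<lambda>x. insert_comp n X i (P (remove_comp n i x)) (remove_comp n i x)) f"
    and "H \<equiv> dirichlet_form \<mu> (\<lambda>x. insert_comp n X i (Q (remove_comp n i x) (x i)) (remove_comp n i x)) f"
  shows "c1 * E \<le> H" and "H \<le> c2 * E"
proof -
  interpret H: gibbs_component n i X \<mu> P Q by fact
  interpret E: gibbs_component n i X \<mu> P "\<lambda>y a. P y" by (rule gibbs_component_exact) fact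
  obtain D where D: "integrable H.\<nu> D" "H = (\<integral>y. D y \<partial>H.\<nu>)"
    "AE y in H.\<nu>. D y = dirichlet_form (P y) (Q y) (\<lambda>a. f (y(i := a)))"
    unfolding H_def using H.dirichlet_form_disintegrate[OF f] by blast
  obtain D' where D': "integrable H.\<nu> D'" "E = (\<integral>y. D' y \<partial>H.\<nu>)"
    "AE y in H.\<nu>. D' y = dirichlet_form (P y) (\<lambda>_. P y) (\<lambda>a. f (y(i := a)))"
    unfolding E_def using E.dirichlet_form_disintegrate[OF f] by blast
  \<comment> \<open>Both instances disintegrate over the same marginal \<open>H.\<nu>\<close>, so
    their integrands can be compared pointwise off one null set.\<close>
  have *: "AE y in H.\<nu>. c1 * D' y \<le> D y \<and> D y \<le> c2 * D' y"
    using D(3) D'(3) gap H.AE_fibre_L2[OF f] AE_space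
  proof eventually_elim
    case (elim y)
    then have "prob_space (P y)" by (intro H.P_prob) (simp add: H.space_marginal)
    with elim show ?case
      using dirichlet_form_gap[of "P y" "\<lambda>a. f (y(i := a))" c1 "Q y" c2] by simp
  qed
  have "(\<integral>y. c1 * D' y \<partial>H.\<nu>) \<le> (\<integral>y. D y \<partial>H.\<nu>)" "(\<integral>y. D y \<partial>H.\<nu>) \<le> (\<integral>y. c2 * D' y \<partial>H.\<nu>)"
    by (intro integral_mono_AE integrable_mult_right D(1) D'(1); use * in auto)+
  then show "c1 * E \<le> H" "H \<le> c2 * E"
    using D'(1) by (simp_all add: D(2) D'(2))
qed

theorem theorem2:
  fixes n :: nat
    and X :: "nat \<Rightarrow> 'a topology"
    and \<mu> :: "(nat \<Rightarrow> 'a) measure"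
    and P :: "nat \<Rightarrow> (nat \<Rightarrow> 'a) \<Rightarrow> 'a measure"
    and Q :: "nat \<Rightarrow> (nat \<Rightarrow> 'a) \<Rightarrow> 'a \<Rightarrow> 'a measure"
    and p :: "nat \<Rightarrow> real"
    and c1 c2 :: real
    and f :: "(nat \<Rightarrow> 'a) \<Rightarrow> real"
  assumes polish: "\<And>i. i \<in> {1..n} \<Longrightarrow> polish_space (X i)"
    and target: "prob_space \<mu>" "sets \<mu> = sets (prod_space n X)"
    and conditional: "\<And>i. i \<in> {1..n} \<Longrightarrow>
      conditional_distribution \<mu> (borel_of (X i)) (\<lambda>x. x i)
        (prod_space_minus n X i) (remove_comp n i) (P i)"
    and kernel: "\<And>i y. i \<in> {1..n} \<Longrightarrow> y \<in> space (prod_space_minus n X i) \<Longrightarrow>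
      markov_kernel (borel_of (X i)) (Q i y) \<and> reversible_wrt (Q i y) (P i y)"
    and kernel_measurable: "\<And>i A. i \<in> {1..n} \<Longrightarrow> A \<in> sets (borel_of (X i)) \<Longrightarrow>
      (\<lambda>x. measure (Q i (remove_comp n i x) (x i)) A) \<in> borel_measurable (prod_space n X)"
    and weights: "\<And>i. i \<in> {1..n} \<Longrightarrow> 0 \<le> p i" "(\<Sum>i=1..n. p i) = 1"
    and constants: "c1 \<in> {0..2}" "c2 \<in> {0..2}"
    and gap: "\<And>i. i \<in> {1..n} \<Longrightarrow>
      AE y in marginal_minus n X \<mu> i.
        \<forall>g\<in>L2_0 (P i y). \<not> (AE a in P i y. g a = 0) \<longrightarrow>
          c1 \<le> dirichlet_form (P i y) (Q i y) g / (L2_norm (P i y) g)\<^sup>2 \<and>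
          dirichlet_form (P i y) (Q i y) g / (L2_norm (P i y) g)\<^sup>2 \<le> c2"
    and f: "f \<in> L2_0 \<mu>"
  shows "c1 * dirichlet_form \<mu> (exact_gibbs n X p P) f
           \<le> dirichlet_form \<mu> (hybrid_gibbs n X p Q) f \<and>
         dirichlet_form \<mu> (hybrid_gibbs n X p Q) f
           \<le> c2 * dirichlet_form \<mu> (exact_gibbs n X p P) f"
proof -
  have H: "gibbs_component n i X \<mu> (P i) (Q i)" if "i \<in> {1..n}" for i
    using that target conditional[OF that] kernel[OF that] kernel_measurable[OF that]
    by (intro gibbs_component.intro) auto
  have fL2: "f \<in> L2 \<mu>" using f by (simp add: L2_0_def)
  have space: "space \<mu> = space (prod_space n X)" by (rule sets_eq_imp_space_eq[OF target(2)])
  define E where "E = (\<lambda>i. dirichlet_form \<mu>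
    (\<lambda>x. insert_comp n X i (P i (remove_comp n i x)) (remove_comp n i x)) f)"
  define F where "F = (\<lambda>i. dirichlet_form \<mu>
    (\<lambda>x. insert_comp n X i (Q i (remove_comp n i x) (x i)) (remove_comp n i x)) f)"
  have exact: "dirichlet_form \<mu> (exact_gibbs n X p P) f = (\<Sum>i=1..n. p i * E i)"
    unfolding E_def
    by (intro dirichlet_form_mixture weights f
        gibbs_component.invariant[OF gibbs_component_exact[OF H]] finite_atLeastAtMost)
      (simp_all add: exact_gibbs_def space target(2))
  have hybrid: "dirichlet_form \<mu> (hybrid_gibbs n X p Q) f = (\<Sum>i=1..n. p i * F i)"
    unfolding F_def
    by (intro dirichlet_form_mixture weights f gibbs_component.invariant[OF H] finite_atLeastAtMost)
      (simp_all add: hybrid_gibbs_def space target(2))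
  have "c1 * E i \<le> F i" "F i \<le> c2 * E i" if "i \<in> {1..n}" for i
    unfolding E_def F_def using gibbs_component_gap[OF H[OF that] gap[OF that] fL2] .
  then have "p i * (c1 * E i) \<le> p i * F i" "p i * F i \<le> p i * (c2 * E i)" if "i \<in> {1..n}" for i
    using weights(1) that by (auto intro!: mult_left_mono)
  then have "(\<Sum>i=1..n. p i * (c1 * E i)) \<le> (\<Sum>i=1..n. p i * F i)"
    "(\<Sum>i=1..n. p i * F i) \<le> (\<Sum>i=1..n. p i * (c2 * E i))"
    by (auto intro!: sum_mono)
  then show ?thesis
    unfolding exact hybrid by (simp add: sum_distrib_left mult.left_commute)
qed

end
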